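(* Let $G$ be the path on vertices $1,\dots,n$ with $n>3$, let $q>4$, and let $\Omega^+=\{0,\dots,q-1\}^n$ be the set of all (proper and improper) $q$-colorings of $G$. Let $\mathcal{M}_{\rightarrow}$ be the systematic scan on the state space $\Omega^+$. Then for all $\varepsilon\in(0,1)$, $$\mathrm{Mix}(\mathcal{M}_{\rightarrow},\varepsilon)\ \le\ 4\log(n\varepsilon^{-1}).$$
   Context: The $n$-vertex path has vertices $1,\dots,n$ and edges $\{i,i+1\}$. A $q$-coloring is a vector $\sigma=(\sigma_1,\dots,\sigma_n)\in\{0,\dots,q-1\}^n$; it is proper if adjacent vertices receive different colors. The procedure Metropolis($v$), applied to any coloring in $\Omega^+$: choose a color $c\in\{0,\dots,q-1\}$ uniformly at random and propose recoloring $v$ with $c$; the proposal is accepted if and only if $c$ is not used at any neighbor of $v$ (otherwise the coloring is unchanged). One step of the Markov chain $\mathcal{M}_{\rightarrow}$ (systematic scan): for $v=1,2,\dots,n$ in this order, do Metropolis($v$) (with independent color choices). The chain never moves from a proper coloring to an improper one; its stationary distribution is uniform on the set $\Omega$ of proper colorings and gives measure zero to $\Omega^+\setminus\Omega$. For a Markov chain $\mathcal{M}$ with transition matrix $P$ and stationary distribution $\pi$, $\mathrm{Mix}_x(\mathcal{M},\varepsilon)=\min\{t>0:\mathrm{d_{TV}}(P^t(x,\cdot),\pi(\cdot))\le\varepsilon\}$ and $\mathrm{Mix}(\mathcal{M},\varepsilon)=\max_x\mathrm{Mix}_x(\mathcal{M},\varepsilon)$, the maximum being over all initial states $x$ in the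 state space $\Omega^+$, where $\mathrm{d_{TV}}(\theta_1,\theta_2)=\frac12\sum_i|\theta_1(i)-\theta_2(i)|$. The logarithm is natural. *)

theory Defs
  imports "HOL-Probability.Probability"
begin

text \<open>A Markov chain is given by its kernel \<open>K\<close>, where \<open>pmf (K x) y\<close> is the transition
  probability from \<open>x\<close> to \<open>y\<close>.\<close>

definition kernel_power :: "('a \<Rightarrow> 'a pmf) \<Rightarrow> nat \<Rightarrow> 'a \<Rightarrow> 'a pmf" where
  "kernel_power K t x = ((\<lambda>p. bind_pmf p K) ^^ t) (return_pmf x)"

definition stationary :: "('a \<Rightarrow> 'a pmf) \<Rightarrow> 'a pmf \<Rightarrow> bool" where
  "stationary K \<pi> \<longleftrightarrow> bind_pmf \<pi> K = \<pi>"

text \<open>\<open>S\<close> is the (finite) state space; it is meant to contain the supports of both arguments.\<close>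

definition tv_dist :: "'a set \<Rightarrow> 'a pmf \<Rightarrow> 'a pmf \<Rightarrow> real" where
  "tv_dist S p r = (\<Sum>i\<in>S. \<bar>pmf p i - pmf r i\<bar>) / 2"

text \<open>Mixing times are extended naturals, so that a chain that never gets within \<open>\<epsilon>\<close> of \<open>\<pi>\<close>
  has mixing time \<open>\<infinity>\<close>.  The infimum is a minimum whenever it is finite, and the supremum is
  a maximum for finite nonempty \<open>S\<close>.\<close>

definition mixing_time_from ::
    "'a set \<Rightarrow> ('a \<Rightarrow> 'a pmf) \<Rightarrow> 'a pmf \<Rightarrow> real \<Rightarrow> 'a \<Rightarrow> enat" where
  "mixing_time_from S K \<pi> \<epsilon> x =
     (INF t \<in> {t. t > 0 \<and> tv_dist S (kernel_power K t x) \<pi> \<le> \<epsilon>}. enat t)"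

definition mixing_time ::
    "'a set \<Rightarrow> ('a \<Rightarrow> 'a pmf) \<Rightarrow> 'a pmf \<Rightarrow> real \<Rightarrow> enat" where
  "mixing_time S K \<pi> \<epsilon> = (SUP x\<in>S. mixing_time_from S K \<pi> \<epsilon> x)"

definition path_adj :: "nat \<Rightarrow> nat \<Rightarrow> nat \<Rightarrow> bool" where
  "path_adj n v w \<longleftrightarrow> (\<exists>i\<in>{1..<n}. {v, w} = {i, i + 1})"

definition colorings :: "nat \<Rightarrow> nat \<Rightarrow> (nat \<Rightarrow> nat) set" where
  "colorings n q = {1..n} \<rightarrow>\<^sub>E {..<q}"

definition proper_colorings :: "nat \<Rightarrow> nat \<Rightarrow> (nat \<Rightarrow> nat) set" where
  "proper_colorings n q = {\<sigma> \<in> colorings n q. \<forall>v w. path_adj n v w \<longrightarrow> \<sigma> v \<noteq> \<sigma> w}"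

definition metropolis :: "nat \<Rightarrow> nat \<Rightarrow> nat \<Rightarrow> (nat \<Rightarrow> nat) \<Rightarrow> (nat \<Rightarrow> nat) pmf" where
  "metropolis n q v \<sigma> =
     map_pmf (\<lambda>c. if \<forall>w. path_adj n v w \<longrightarrow> \<sigma> w \<noteq> c then \<sigma>(v := c) else \<sigma>)
       (pmf_of_set {..<q})"

definition systematic_scan :: "nat \<Rightarrow> nat \<Rightarrow> (nat \<Rightarrow> nat) \<Rightarrow> (nat \<Rightarrow> nat) pmf" where
  "systematic_scan n q \<sigma> =
     fold (\<lambda>v p. bind_pmf p (metropolis n q v)) [1..<n + 1] (return_pmf \<sigma>)"

definition uniform_proper :: "nat \<Rightarrow> nat \<Rightarrow> (nat \<Rightarrow> nat) pmf" where
  "uniform_proper n q = pmf_of_set (proper_colorings n q)"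

lemma path_adj_irrefl: "\<not> path_adj n v v"
  by (auto simp: path_adj_def doubleton_eq_iff)

lemma path_adj_sym: "path_adj n v w \<longleftrightarrow> path_adj n w v"
  by (simp add: path_adj_def insert_commute)

lemma finite_proper_colorings: "finite (proper_colorings n q)"
  by (simp add: proper_colorings_def colorings_def finite_PiE)

lemma proper_colorings_nonempty:
  assumes "q \<ge> 2"
  shows "proper_colorings n q \<noteq> {}"
proof -
  have "restrict (\<lambda>v. v mod 2) {1..n} \<in> proper_colorings n q"
    using assms
    by (auto simp: proper_colorings_def colorings_def path_adj_def doubleton_eq_iff
             intro: less_le_trans[of _ 2]) presburger+
  then show ?thesis by blast
qed

lemma fun_upd_proper_colorings:
  assumes "\<sigma> \<in> proper_colorings n q" "v \<in> {1..n}" "c < q"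
    and "\<forall>w. path_adj n v w \<longrightarrow> \<sigma> w \<noteq> c"
  shows "\<sigma>(v := c) \<in> proper_colorings n q"
proof -
  have "\<sigma>(v := c) \<in> colorings n q"
    using assms(1-3) by (auto simp: proper_colorings_def colorings_def PiE_iff extensional_def)
  then show ?thesis
    using assms path_adj_irrefl path_adj_sym by (fastforce simp: proper_colorings_def)
qed

lemma stationary_metropolis:
  assumes "q \<ge> 2" "v \<in> {1..n}"
  shows "stationary (metropolis n q v) (uniform_proper n q)"
proof -
  let ?O = "proper_colorings n q" and ?C = "{..<q}"
  define ok where "ok \<sigma> c \<longleftrightarrow> (\<forall>w. path_adj n v w \<longrightarrow> \<sigma> w \<noteq> c)" for \<sigma> :: "nat \<Rightarrow> nat" and c
  define g where "g = (\<lambda>(\<sigma>, c). if ok \<sigma> c then (\<sigma>(v := c), \<sigma> v) else (\<sigma>, c))"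
  note ne = proper_colorings_nonempty[OF assms(1), of n]
  have C: "?C \<noteq> {}" using assms(1) by (auto simp: lessThan_empty_iff)
  have okv: "ok (\<sigma>(v := c)) (\<sigma> v)" if "\<sigma> \<in> ?O" for \<sigma> c
    using that path_adj_irrefl[of n v] by (force simp: ok_def proper_colorings_def)
  have gg: "g (g x) = x" if "x \<in> ?O \<times> ?C" for x
    using that okv by (cases x) (auto simp: g_def)
  have gm: "g x \<in> ?O \<times> ?C" if "x \<in> ?O \<times> ?C" for x
  proof -
    obtain \<sigma> c where x: "x = (\<sigma>, c)" by (cases x)
    have "\<sigma> v < q"
      using that assms(2) by (auto simp: x proper_colorings_def colorings_def PiE_iff)
    then show ?thesis
      using that assms(2) fun_upd_proper_colorings[of \<sigma> n q v c]
      by (auto simp: x g_def ok_def)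
  qed
  have bij: "bij_betw g (?O \<times> ?C) (?O \<times> ?C)"
    by (rule bij_betw_byWitness[where f' = g]) (use gg gm in blast)+
  have pair: "pair_pmf (pmf_of_set ?O) (pmf_of_set ?C) = pmf_of_set (?O \<times> ?C)"
    by (rule pmf_eqI)
       (auto simp: pmf_pair pmf_of_set ne C finite_proper_colorings indicator_def
             card_cartesian_product split: prod.splits)
  have fg: "fst (g (\<sigma>, c)) = (if ok \<sigma> c then \<sigma>(v := c) else \<sigma>)" for \<sigma> c
    by (simp add: g_def)
  have "bind_pmf (uniform_proper n q) (metropolis n q v)
      = map_pmf (\<lambda>x. fst (g x)) (pair_pmf (pmf_of_set ?O) (pmf_of_set ?C))"
    unfolding uniform_proper_def metropolis_def pair_pmf_def map_pmf_def
      bind_assoc_pmf bind_return_pmf fg ok_def ..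
  also have "\<dots> = map_pmf fst (map_pmf g (pmf_of_set (?O \<times> ?C)))"
    by (simp add: pair map_pmf_comp)
  also have "map_pmf g (pmf_of_set (?O \<times> ?C)) = pmf_of_set (?O \<times> ?C)"
    using map_pmf_of_set_bij_betw[OF bij] ne C finite_proper_colorings by auto
  also have "map_pmf fst (pmf_of_set (?O \<times> ?C)) = uniform_proper n q"
    by (simp flip: pair add: map_fst_pair_pmf uniform_proper_def)
  finally show ?thesis by (simp add: stationary_def)
qed

lemma bind_fold_kernels:
  "bind_pmf p (\<lambda>x. fold (\<lambda>v r. bind_pmf r (K v)) vs (return_pmf x))
     = fold (\<lambda>v r. bind_pmf r (K v)) vs p"
proof (induction vs arbitrary: p rule: rev_induct)
  case Nil
  show ?case by (simp add: bind_return_pmf')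
next
  case (snoc v vs)
  then show ?case by (simp flip: bind_assoc_pmf)
qed

text \<open>This justifies using \<open>uniform_proper\<close> as the target distribution of the scan.\<close>

lemma stationary_systematic_scan:
  assumes "q \<ge> 2"
  shows "stationary (systematic_scan n q) (uniform_proper n q)"
proof -
  have "fold (\<lambda>v p. bind_pmf p (metropolis n q v)) vs (uniform_proper n q) = uniform_proper n q"
    if "set vs \<subseteq> {1..n}" for vs
    using that stationary_metropolis[OF assms]
    by (induction vs) (auto simp: stationary_def)
  from this[of "[1..<n + 1]", unfolded set_upt]
  have "fold (\<lambda>v p. bind_pmf p (metropolis n q v)) [1..<n + 1] (uniform_proper n q)
      = uniform_proper n q"
    by (simp only: Suc_eq_plus1[symmetric] atLeastLessThanSuc_atLeastAtMost order_refl)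
  then show ?thesis
    by (simp only: stationary_def systematic_scan_def[abs_def] bind_fold_kernels)
qed

end

theory Submission
  imports Defs
begin

text \<open>
  Instead of coupling two copies of the chain, the proof follows what the kernels do to test
  functions, in the spirit of Dobrushin: a kernel acts on a function by averaging, and one keeps
  track, for every site, of the oscillation of the function, that is, of the largest change of
  its value that recoloring this site alone can cause.

  Averaging over Metropolis(\<open>v\<close>) multiplies the oscillation at \<open>v\<close> by at most
  \<open>2/q\<close>, since two colorings that differ only at \<open>v\<close> are merged unless the proposed
  color is one of the at most two colors next to \<open>v\<close>
  (\<open>osc_metropolis_self\<close>).  It adds to the oscillation at each neighbor of \<open>v\<close>
  at most \<open>1/q\<close> times the oscillation at \<open>v\<close>
  (\<open>osc_metropolis_adjacent\<close>), and it does not increase the oscillation at any other site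
  (\<open>osc_metropolis_nonadjacent\<close>).  The average over a whole scan is the composition of these
  averages in which site \<open>n\<close> comes first and site \<open>1\<close> last.  If all oscillations are at
  most \<open>d\<close> at the start, then a site has oscillation at most \<open>d + (1/5) (5/4) d = 5d/4\<close>
  when its turn comes, at most \<open>(2/5) (5/4) d = d/2\<close> right afterwards, and at most
  \<open>d/2 + (1/5) (5/4) d = 3d/4\<close> after its left neighbor has been averaged, too
  (\<open>osc_sweep\<close>).  So each scan contracts the oscillations by \<open>3/4\<close>.

  Summing over the sites, the probabilities of an event after \<open>t\<close> scans from any two colorings
  differ by at most about \<open>n (3/4)^t\<close>, and stationarity turns this into a bound for the total
  variation distance.  As \<open>3/4 < exp (-1/4)\<close>, this suffices up to rounding: a mixing time is an
  integer, so the claim needs the bound at \<open>t = \<lfloor>4 ln (n/\<epsilon>)\<rfloor>\<close>.  For \<open>n = 4\<close> and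
  \<open>n = 5\<close> and some \<open>\<epsilon>\<close> the bound \<open>n (3/4)^t\<close> is slightly too weak
  there.  But site \<open>1\<close> has no left neighbor, so its oscillation after a scan is at most
  \<open>d/2\<close>; this improves the bound to \<open>(n - 1/3) (3/4)^t\<close>, which is enough
  (\<open>power_floor_bound\<close>).
\<close>

section \<open>Kernels acting on functions\<close>

definition mean :: "('a \<Rightarrow> 'b pmf) \<Rightarrow> ('b \<Rightarrow> real) \<Rightarrow> 'a \<Rightarrow> real" where
  "mean K f x = measure_pmf.expectation (K x) f"

lemma expectation_bind_finite:
  assumes "finite (set_pmf p)" "\<And>x. finite (set_pmf (K x))"
  shows "measure_pmf.expectation (bind_pmf p K) f = measure_pmf.expectation p (mean K f)"
  using assms
  by (simp add: pmf_expectation_bind[of "set_pmf p"] mean_def[abs_def]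
      integral_measure_pmf[of "set_pmf p"])

lemma kernel_power_0: "kernel_power K 0 x = return_pmf x"
  by (simp add: kernel_power_def)

lemma kernel_power_Suc: "kernel_power K (Suc t) x = bind_pmf (kernel_power K t x) K"
  by (simp add: kernel_power_def)

lemma finite_set_kernel_power:
  assumes "\<And>x. finite (set_pmf (K x))"
  shows "finite (set_pmf (kernel_power K t x))"
  by (induction t) (simp_all add: kernel_power_0 kernel_power_Suc assms)

lemma mean_kernel_power_Suc:
  assumes "\<And>x. finite (set_pmf (K x))"
  shows "mean (kernel_power K (Suc t)) f = mean (kernel_power K t) (mean K f)"
  by (simp add: fun_eq_iff mean_def[of "kernel_power K _"] kernel_power_Suc
      expectation_bind_finite finite_set_kernel_power assms)

lemma stationary_kernel_power:
  assumes "stationary K \<pi>"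
  shows "stationary (kernel_power K t) \<pi>"
proof (induction t)
  case 0
  show ?case by (simp add: stationary_def kernel_power_0[abs_def] bind_return_pmf')
next
  case (Suc t)
  then show ?case
    using assms by (simp add: stationary_def kernel_power_Suc[abs_def] flip: bind_assoc_pmf)
qed

text \<open>The total variation distance is half the sum of the largest excess of either distribution
  over the other, and each excess is attained on one event.  By stationarity, the probability of
  an event under \<open>\<pi>\<close> is a \<open>\<pi>\<close>-average of its probabilities after starting the kernel in
  the various states.\<close>

lemma tv_dist_le_of_mean_indicator:
  assumes fin: "finite S" "finite (set_pmf \<pi>)" "set_pmf \<pi> \<subseteq> S" "\<And>x. finite (set_pmf (K x))"
    and stat: "stationary K \<pi>" and "x \<in> S"
    and close: "\<And>A y. y \<in> S \<Longrightarrow> \<bar>mean K (indicat_real A) x - mean K (indicat_real A) y\<bar> \<le> B"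
  shows "tv_dist S (K x) \<pi> \<le> B"
proof -
  have event: "\<bar>(\<Sum>i\<in>A. pmf (K x) i) - (\<Sum>i\<in>A. pmf \<pi> i)\<bar> \<le> B" if "A \<subseteq> S" for A
  proof -
    let ?G = "mean K (indicat_real A)"
    have "finite A" using that fin(1) finite_subset by blast
    then have sums: "(\<Sum>i\<in>A. pmf p i) = measure_pmf.expectation p (indicat_real A)" for p
      by (simp add: measure_measure_pmf_finite)
    have "measure_pmf.expectation \<pi> (indicat_real A) = measure_pmf.expectation \<pi> ?G"
      using expectation_bind_finite[OF fin(2), of K "indicat_real A"] fin(4) stat
      by (simp add: stationary_def)
    moreover have "measure_pmf.expectation \<pi> ?G \<le> ?G x + B"
      by (rule measure_pmf.integral_le_const)
         (use close[of _ A] fin(3) in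
           \<open>fastforce simp: AE_measure_pmf_iff integrable_measure_pmf_finite[OF fin(2)] abs_le_iff\<close>)+
    moreover have "measure_pmf.expectation \<pi> ?G \<ge> ?G x - B"
      by (rule measure_pmf.integral_ge_const)
         (use close[of _ A] fin(3) in
           \<open>fastforce simp: AE_measure_pmf_iff integrable_measure_pmf_finite[OF fin(2)] abs_le_iff\<close>)+
    ultimately show ?thesis
      unfolding sums by (simp only: mean_def abs_le_iff) linarith
  qed
  \<comment> \<open>The set \<open>A\<close> is the event on which the kernel exceeds the target the most, and
    \<open>S - A\<close> the one on which it falls short the most.\<close>
  define A where "A = {i \<in> S. pmf \<pi> i \<le> pmf (K x) i}"
  have "A \<subseteq> S" by (auto simp: A_def)
  have "(\<Sum>i\<in>S. \<bar>pmf (K x) i - pmf \<pi> i\<bar>)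
      = (\<Sum>i\<in>S - A. \<bar>pmf (K x) i - pmf \<pi> i\<bar>) + (\<Sum>i\<in>A. \<bar>pmf (K x) i - pmf \<pi> i\<bar>)"
    using \<open>A \<subseteq> S\<close> fin(1) by (rule sum.subset_diff)
  also have "(\<Sum>i\<in>A. \<bar>pmf (K x) i - pmf \<pi> i\<bar>) = (\<Sum>i\<in>A. pmf (K x) i - pmf \<pi> i)"
    by (rule sum.cong) (auto simp: A_def)
  also have "(\<Sum>i\<in>S - A. \<bar>pmf (K x) i - pmf \<pi> i\<bar>) = (\<Sum>i\<in>S - A. pmf \<pi> i - pmf (K x) i)"
    by (rule sum.cong) (auto simp: A_def)
  finally show ?thesis
    using event[of A] event[of "S - A"] \<open>A \<subseteq> S\<close>
    by (simp add: tv_dist_def sum_subtractf)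
qed

section \<open>Oscillation of functions on colorings\<close>

definition osc_le :: "nat \<Rightarrow> nat \<Rightarrow> ((nat \<Rightarrow> nat) \<Rightarrow> real) \<Rightarrow> nat \<Rightarrow> real \<Rightarrow> bool" where
  "osc_le n q f v d \<longleftrightarrow> (\<forall>\<sigma>\<in>colorings n q. \<forall>c<q. \<bar>f (\<sigma>(v := c)) - f \<sigma>\<bar> \<le> d)"

lemma osc_leD:
  assumes "osc_le n q f v d" "\<sigma> \<in> colorings n q" "c < q"
  shows "\<bar>f (\<sigma>(v := c)) - f \<sigma>\<bar> \<le> d"
  using assms by (simp add: osc_le_def)

lemma osc_le_mono: "osc_le n q f v d \<Longrightarrow> d \<le> e \<Longrightarrow> osc_le n q f v e"
  by (fastforce simp: osc_le_def)

lemma osc_le_indicator: "osc_le n q (indicator A) v 1"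
  by (simp add: osc_le_def indicator_def)

lemma fun_upd_colorings:
  assumes "\<sigma> \<in> colorings n q" "v \<in> {1..n}" "c < q"
  shows "\<sigma>(v := c) \<in> colorings n q"
  using assms by (auto simp: colorings_def PiE_iff extensional_def)

lemma colorings_less: "\<sigma> \<in> colorings n q \<Longrightarrow> v \<in> {1..n} \<Longrightarrow> \<sigma> v < q"
  by (auto simp: colorings_def PiE_iff)

text \<open>Recolor \<open>x\<close> into \<open>y\<close> one site at a time.\<close>

lemma diff_le_sum_osc:
  assumes x: "x \<in> colorings n q" and y: "y \<in> colorings n q"
    and osc: "\<And>v. v \<in> {1..n} \<Longrightarrow> osc_le n q f v (d v)"
  shows "\<bar>f x - f y\<bar> \<le> (\<Sum>v=1..n. d v)"
proof -
  \<comment> \<open>the coloring that is reached when the first \<open>k\<close> sites have been recolored\<close>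
  define z where "z k = (\<lambda>i. if i \<le> k then y i else x i)" for k :: nat
  have z0: "z 0 = x" and zn: "z n = y"
    using x y by (fastforce simp: z_def fun_eq_iff colorings_def PiE_iff extensional_def)+
  have "z k \<in> colorings n q \<and> \<bar>f (z k) - f x\<bar> \<le> (\<Sum>v=1..k. d v)" if "k \<le> n" for k
    using that
  proof (induction k)
    case 0
    show ?case using x by (simp add: z0)
  next
    case (Suc k)
    have upd: "z (Suc k) = (z k)(Suc k := y (Suc k))"
      by (auto simp: z_def fun_eq_iff)
    have "y (Suc k) < q" using Suc.prems y by (auto intro: colorings_less)
    then show ?case
      using Suc fun_upd_colorings[of "z k" n q "Suc k" "y (Suc k)"]
        osc_leD[OF osc, of "Suc k" "z k" "y (Suc k)"]
      unfolding upd by (simp del: fun_upd_apply) linarith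
  qed
  from this[of n] show ?thesis by (simp add: zn abs_minus_commute)
qed

section \<open>Oscillations after a single Metropolis update\<close>

lemma path_adj_cases: "path_adj n v w \<Longrightarrow> w = v - 1 \<or> w = v + 1"
  by (auto simp: path_adj_def doubleton_eq_iff)

lemma finite_set_metropolis: "q > 0 \<Longrightarrow> finite (set_pmf (metropolis n q v \<sigma>))"
  by (simp add: metropolis_def lessThan_empty_iff)

lemma mean_metropolis:
  assumes "q > 0"
  shows "mean (metropolis n q v) f \<sigma> =
    (\<Sum>c<q. if \<forall>w. path_adj n v w \<longrightarrow> \<sigma> w \<noteq> c then f (\<sigma>(v := c)) else f \<sigma>) / q"
proof -
  have "{..<q} \<noteq> {}" using assms by (auto simp: lessThan_empty_iff)
  then show ?thesis
    by (simp add: mean_def metropolis_def integral_pmf_of_set if_distrib cong: if_cong)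
qed

text \<open>Two colorings that differ only at \<open>v\<close> accept the same proposals at \<open>v\<close>, and an accepted
  proposal makes them equal.  So a difference survives only the rejected colors.\<close>

lemma osc_metropolis_self:
  assumes "q > 0" and osc: "osc_le n q f v d"
  shows "osc_le n q (mean (metropolis n q v) f) v (2 * d / q)"
  unfolding osc_le_def
proof (intro ballI allI impI)
  fix \<sigma> a assume \<sigma>: "\<sigma> \<in> colorings n q" and a: "a < q"
  let ?free = "\<lambda>c. \<forall>w. path_adj n v w \<longrightarrow> \<sigma> w \<noteq> c"
  have free: "(\<forall>w. path_adj n v w \<longrightarrow> (\<sigma>(v := a)) w \<noteq> c) \<longleftrightarrow> ?free c" for c
    using path_adj_irrefl[of n v] by (metis fun_upd_apply)
  have D: "\<bar>f (\<sigma>(v := a)) - f \<sigma>\<bar> \<le> d" using osc_leD[OF osc \<sigma> a] .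
  have "{c \<in> {..<q}. \<not> ?free c} \<subseteq> {\<sigma> (v - 1), \<sigma> (v + 1)}"
    using path_adj_cases by auto
  then have "card {c \<in> {..<q}. \<not> ?free c} \<le> card {\<sigma> (v - 1), \<sigma> (v + 1)}"
    by (intro card_mono) auto
  also have "\<dots> \<le> 2" by (simp add: card_insert_if)
  finally have card: "real (card {c \<in> {..<q}. \<not> ?free c}) \<le> 2" by simp
  have "\<bar>(\<Sum>c<q. if ?free c then f (\<sigma>(v := c)) else f (\<sigma>(v := a)))
       - (\<Sum>c<q. if ?free c then f (\<sigma>(v := c)) else f \<sigma>)\<bar>
      = \<bar>\<Sum>c<q. if \<not> ?free c then f (\<sigma>(v := a)) - f \<sigma> else 0\<bar>"
    unfolding sum_subtractf[symmetric]
    by (intro arg_cong[of _ _ abs] sum.cong) auto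
  also have "\<dots> \<le> (\<Sum>c<q. if \<not> ?free c then d else 0)"
    by (rule order_trans[OF sum_abs], rule sum_mono) (use D in auto)
  also have "\<dots> = card {c \<in> {..<q}. \<not> ?free c} * d"
    by (subst sum.inter_filter[symmetric]) simp_all
  also have "\<dots> \<le> 2 * d" using card D by (intro mult_right_mono) linarith+
  finally show "\<bar>mean (metropolis n q v) f (\<sigma>(v := a)) - mean (metropolis n q v) f \<sigma>\<bar> \<le> 2 * d / q"
    unfolding mean_metropolis[OF assms(1)] free fun_upd_upd
    by (simp add: assms(1) divide_right_mono flip: diff_divide_distrib)
qed

text \<open>Acceptance at \<open>v\<close> does not depend on the color of \<open>i\<close>, and the update commutes with
  recoloring \<open>i\<close>.\<close>

lemma osc_metropolis_nonadjacent:
  assumes "q > 0" "v \<in> {1..n}" "i \<noteq> v" "\<not> path_adj n v i" and osc: "osc_le n q f i d"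
  shows "osc_le n q (mean (metropolis n q v) f) i d"
  unfolding osc_le_def
proof (intro ballI allI impI)
  fix \<sigma> a assume \<sigma>: "\<sigma> \<in> colorings n q" and a: "a < q"
  let ?free = "\<lambda>c. \<forall>w. path_adj n v w \<longrightarrow> \<sigma> w \<noteq> c"
  have free: "(\<forall>w. path_adj n v w \<longrightarrow> (\<sigma>(i := a)) w \<noteq> c) \<longleftrightarrow> ?free c" for c
    using assms(4) by (metis fun_upd_apply)
  have "\<bar>(\<Sum>c<q. if ?free c then f (\<sigma>(i := a, v := c)) else f (\<sigma>(i := a)))
       - (\<Sum>c<q. if ?free c then f (\<sigma>(v := c)) else f \<sigma>)\<bar> \<le> (\<Sum>c<q. d)"
    unfolding sum_subtractf[symmetric]
  proof (rule order_trans[OF sum_abs], rule sum_mono)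
    fix c assume "c \<in> {..<q}"
    then have "\<bar>f (\<sigma>(v := c, i := a)) - f (\<sigma>(v := c))\<bar> \<le> d"
      using assms(2) \<sigma> a by (intro osc_leD[OF osc] fun_upd_colorings) auto
    then show "\<bar>(if ?free c then f (\<sigma>(i := a, v := c)) else f (\<sigma>(i := a)))
       - (if ?free c then f (\<sigma>(v := c)) else f \<sigma>)\<bar> \<le> d"
      using osc_leD[OF osc \<sigma> a] assms(3) by (auto simp: fun_upd_twist)
  qed
  then show "\<bar>mean (metropolis n q v) f (\<sigma>(i := a)) - mean (metropolis n q v) f \<sigma>\<bar> \<le> d"
    unfolding mean_metropolis[OF assms(1)] free
    using assms(1) by (simp add: field_simps flip: diff_divide_distrib)
qed

text \<open>Let two colorings differ only at the neighbor \<open>i\<close> of \<open>v\<close>, with colors \<open>a\<close> and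
  \<open>b\<close> there.  Only the proposals \<open>a\<close> and \<open>b\<close> can lead to different colors at
  \<open>v\<close>.  When neither is blocked by the other neighbor of \<open>v\<close>, each coloring
  rejects one of them and accepts the other; matching rejection with rejection and acceptance with
  acceptance leaves only one of the two proposals on which the colors at \<open>v\<close> differ.  This is
  why the additional term is \<open>e / q\<close> and not \<open>2 * e / q\<close>.\<close>

lemma osc_metropolis_adjacent:
  assumes "q > 0" and v: "v \<in> {1..n}" and adj: "path_adj n v i"
    and osci: "osc_le n q f i d" and oscv: "osc_le n q f v e"
  shows "osc_le n q (mean (metropolis n q v) f) i (d + e / q)"
  unfolding osc_le_def
proof (intro ballI allI impI)
  fix \<sigma> b assume \<sigma>: "\<sigma> \<in> colorings n q" and b: "b < q"
  have iv: "i \<noteq> v" using adj path_adj_irrefl by metis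
  have i: "i \<in> {1..n}" using adj by (auto simp: path_adj_def doubleton_eq_iff)
  define a s where "a = \<sigma> i" and "s = \<sigma> v"
  define g h where "g c = f (\<sigma>(v := c))" and "h c = f (\<sigma>(i := b, v := c))" for c
  have a: "a < q" and s: "s < q" using \<sigma> v i by (auto simp: a_def s_def colorings_less)
  have "(\<sigma>(i := b))(v := \<sigma> v) = \<sigma>(i := b)"
    using iv by (intro fun_upd_idem) simp
  then have fg: "f \<sigma> = g s" and fh: "f (\<sigma>(i := b)) = h s"
    by (simp_all add: g_def h_def s_def)
  have gh: "\<bar>h c - g c\<bar> \<le> d" if "c < q" for c
    using osc_leD[OF osci fun_upd_colorings[OF \<sigma> v that] b] iv
    by (simp add: g_def h_def fun_upd_twist)
  have gg: "\<bar>g c' - g c\<bar> \<le> e" if "c < q" "c' < q" for c c'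
    using osc_leD[OF oscv fun_upd_colorings[OF \<sigma> v that(1)] that(2)] by (simp add: g_def)
  \<comment> \<open>colors that both colorings reject because of a neighbor of \<open>v\<close> other than \<open>i\<close>\<close>
  define used where "used c \<longleftrightarrow> (\<exists>w. w \<noteq> i \<and> path_adj n v w \<and> \<sigma> w = c)" for c
  define G where "G c = (if used c \<or> c = a then g s else g c)" for c
  define H where "H c = (if used c \<or> c = b then h s else h c)" for c
  have G: "(if \<forall>w. path_adj n v w \<longrightarrow> \<sigma> w \<noteq> c then f (\<sigma>(v := c)) else f \<sigma>) = G c" for c
    using adj unfolding G_def used_def a_def fg g_def[symmetric] by metis
  have H: "(if \<forall>w. path_adj n v w \<longrightarrow> (\<sigma>(i := b)) w \<noteq> c then f (\<sigma>(i := b, v := c))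
      else f (\<sigma>(i := b))) = H c" for c
    using adj unfolding H_def used_def fh h_def[symmetric] by (smt (verit) fun_upd_apply)
  have "e \<ge> 0" using gg[OF a a] by simp
  have off: "\<bar>H c - G c\<bar> \<le> d" if "c < q" "c \<noteq> a" "c \<noteq> b" for c
    using gh[OF that(1)] gh[OF s] that by (simp add: G_def H_def)
  have "\<bar>(\<Sum>c<q. H c - G c)\<bar> \<le> q * d + e"
  proof (cases "a = b")
    case True
    then have "\<bar>H c - G c\<bar> \<le> d" if "c < q" for c
      using gh[OF that] gh[OF s] by (simp add: G_def H_def)
    then have "\<bar>(\<Sum>c<q. H c - G c)\<bar> \<le> (\<Sum>c<q. d)"
      by (intro order_trans[OF sum_abs] sum_mono) auto
    then show ?thesis using \<open>e \<ge> 0\<close> by simp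
  next
    case False
    \<comment> \<open>The proposals \<open>a\<close> and \<open>b\<close> have to be estimated jointly: separately, each could
      cost \<open>d + e\<close>.\<close>
    have pair: "\<bar>(H a - G a) + (H b - G b)\<bar> \<le> 2 * d + e"
      using gh[OF a] gh[OF b] gh[OF s] gg[OF a b] gg[OF a s] gg[OF s b] gg[OF s a] gg[OF b s] False \<open>e \<ge> 0\<close>
      unfolding G_def H_def abs_le_iff by (cases "used a"; cases "used b"; simp)
    have "(\<Sum>c<q. H c - G c) = (\<Sum>c\<in>{..<q} - {a, b}. H c - G c) + (\<Sum>c\<in>{a, b}. H c - G c)"
      using a b by (intro sum.subset_diff) auto
    moreover have "\<bar>\<Sum>c\<in>{..<q} - {a, b}. H c - G c\<bar> \<le> (\<Sum>c\<in>{..<q} - {a, b}. d)"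
      using off by (intro order_trans[OF sum_abs] sum_mono) auto
    moreover have "(\<Sum>c\<in>{..<q} - {a, b}. d) = (real q - 2) * d"
      using a b False by (simp add: card_Diff_subset)
    ultimately show ?thesis
      using pair False by (simp add: algebra_simps)
  qed
  then show "\<bar>mean (metropolis n q v) f (\<sigma>(i := b)) - mean (metropolis n q v) f \<sigma>\<bar> \<le> d + e / q"
    unfolding mean_metropolis[OF assms(1)] G H
    using assms(1) by (simp add: field_simps sum_subtractf flip: diff_divide_distrib)
qed

section \<open>Oscillations after a scan\<close>

text \<open>A scan restricted to a list of sites, so that initial averages of a full scan (which belong to
  final segments of the list) can be treated by induction.\<close>

definition sweep :: "nat \<Rightarrow> nat \<Rightarrow> nat list \<Rightarrow> (nat \<Rightarrow> nat) \<Rightarrow> (nat \<Rightarrow> nat) pmf" where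
  "sweep n q vs \<sigma> = fold (\<lambda>v p. bind_pmf p (metropolis n q v)) vs (return_pmf \<sigma>)"

lemma sweep_Cons: "sweep n q (v # vs) \<sigma> = bind_pmf (metropolis n q v \<sigma>) (sweep n q vs)"
  unfolding sweep_def[abs_def] bind_fold_kernels by (simp add: bind_return_pmf)

lemma finite_set_sweep: "q > 0 \<Longrightarrow> finite (set_pmf (sweep n q vs \<sigma>))"
  by (induction vs arbitrary: \<sigma>)
     (simp_all add: sweep_Cons finite_set_metropolis, simp add: sweep_def)

lemma mean_sweep_Nil: "mean (sweep n q []) f = f"
  by (simp add: mean_def sweep_def fun_eq_iff)

lemma mean_sweep_Cons:
  assumes "q > 0"
  shows "mean (sweep n q (v # vs)) f = mean (metropolis n q v) (mean (sweep n q vs) f)"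
  by (simp add: fun_eq_iff mean_def[of "sweep n q (_ # _)"] mean_def[of "metropolis n q v"]
      sweep_Cons expectation_bind_finite finite_set_metropolis finite_set_sweep assms)

text \<open>Oscillation at \<open>j\<close>, relative to the start, after averaging over the updates of the sites
  \<open>n, \<dots>, k\<close>.  The values are the fixed points of the recursion for \<open>q = 5\<close>: the site
  \<open>k - 1\<close> about to be averaged has \<open>5/4 = 1 + (1/5) (5/4)\<close>, the site \<open>k\<close> has
  \<open>1/2 = (2/5) (5/4)\<close>, and those behind it \<open>3/4 = 1/2 + (1/5) (5/4)\<close>.\<close>

definition scan_profile :: "nat \<Rightarrow> nat \<Rightarrow> real" where
  "scan_profile k j =
     (if j > k then 3 / 4 else if j = k then 1 / 2 else if j + 1 = k then 5 / 4 else 1)"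

text \<open>Averaging over Metropolis(\<open>k\<close>) moves the profile on by one site: the hypotheses on
  \<open>g\<close> are the profile for \<open>k + 1\<close>, relaxed to include the initial situation \<open>k = n\<close>.\<close>

lemma osc_metropolis_profile:
  assumes q: "q > 4" and "d \<ge> 0" and k: "k \<in> {1..n}" and j: "j \<in> {1..n}"
    and gk: "osc_le n q g k (5 / 4 * d)"
    and before: "\<And>i. i \<in> {1..<k} \<Longrightarrow> osc_le n q g i d"
    and succ: "k + 1 \<le> n \<Longrightarrow> osc_le n q g (k + 1) (1 / 2 * d)"
    and after: "\<And>i. i \<in> {k + 2..n} \<Longrightarrow> osc_le n q g i (3 / 4 * d)"
  shows "osc_le n q (mean (metropolis n q k) g) j (scan_profile k j * d)"
proof -
  have q0: "q > 0" and q5: "real q \<ge> 5" using q by linarith+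
  have small: "5 / 4 * d / q \<le> d / 4" "2 * (5 / 4 * d) / q \<le> d / 2"
    using q0 mult_right_mono[OF q5 \<open>d \<ge> 0\<close>] by (simp_all add: field_simps)
  have next_adj: "path_adj n i (i + 1)" "path_adj n (i + 1) i" if "i \<in> {1..<n}" for i
    using that by (auto simp: path_adj_def insert_commute)
  consider "j = k" | "j + 1 = k" | "j = k + 1" | "j + 1 < k" | "k + 1 < j" by linarith
  then show ?thesis
  proof cases
    case 1
    have "osc_le n q (mean (metropolis n q k) g) k (2 * (5 / 4 * d) / q)"
      using gk by (rule osc_metropolis_self[OF q0])
    from osc_le_mono[OF this small(2)] show ?thesis using 1 by (simp add: scan_profile_def)
  next
    case 2
    have "osc_le n q (mean (metropolis n q k) g) j (d + 5 / 4 * d / q)"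
      using 2 j k next_adj[of j] by (intro osc_metropolis_adjacent[OF q0 k _ before gk]) auto
    then have "osc_le n q (mean (metropolis n q k) g) j (5 / 4 * d)"
      by (rule osc_le_mono) (use small(1) in linarith)
    then show ?thesis using 2 by (auto simp: scan_profile_def)
  next
    case 3
    have "osc_le n q (mean (metropolis n q k) g) j (1 / 2 * d + 5 / 4 * d / q)"
      using 3 j k next_adj[of k] succ by (intro osc_metropolis_adjacent[OF q0 k _ _ gk]) auto
    then have "osc_le n q (mean (metropolis n q k) g) j (3 / 4 * d)"
      by (rule osc_le_mono) (use small(1) in linarith)
    then show ?thesis using 3 by (simp add: scan_profile_def)
  next
    case 4
    then have "osc_le n q (mean (metropolis n q k) g) j d"
      using j path_adj_cases[of n k j]
      by (intro osc_metropolis_nonadjacent[OF q0 k _ _ before]) auto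
    then show ?thesis using 4 by (simp add: scan_profile_def)
  next
    case 5
    then have "osc_le n q (mean (metropolis n q k) g) j (3 / 4 * d)"
      using j path_adj_cases[of n k j]
      by (intro osc_metropolis_nonadjacent[OF q0 k _ _ after]) auto
    then show ?thesis using 5 by (simp add: scan_profile_def)
  qed
qed

lemma osc_sweep:
  assumes q: "q > 4" and "d \<ge> 0" and "1 \<le> k" "k \<le> n"
    and osc: "\<And>j. j \<in> {1..n} \<Longrightarrow> osc_le n q f j d" and "j \<in> {1..n}"
  shows "osc_le n q (mean (sweep n q [k..<n + 1]) f) j (scan_profile k j * d)"
  using \<open>k \<le> n\<close> \<open>1 \<le> k\<close> \<open>j \<in> {1..n}\<close>
proof (induction k arbitrary: j rule: inc_induct)
  case base
  have "osc_le n q (mean (metropolis n q n) f) j (scan_profile n j * d)"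
    using base osc osc_le_mono[OF osc[of n], of "5 / 4 * d"] \<open>d \<ge> 0\<close>
    by (intro osc_metropolis_profile[OF q]) auto
  then show ?case using q by (simp add: mean_sweep_Cons mean_sweep_Nil)
next
  case (step k)
  have IH: "osc_le n q (mean (sweep n q [k + 1..<n + 1]) f) i (scan_profile (k + 1) i * d)"
    if "i \<in> {1..n}" for i
    using step.IH that by simp
  have upt: "[k..<n + 1] = k # [k + 1..<n + 1]"
    using step.hyps by (simp add: upt_conv_Cons)
  have "osc_le n q (mean (metropolis n q k) (mean (sweep n q [k + 1..<n + 1]) f)) j
      (scan_profile k j * d)"
  proof (rule osc_metropolis_profile[OF q \<open>d \<ge> 0\<close>])
    show "osc_le n q (mean (sweep n q [k + 1..<n + 1]) f) k (5 / 4 * d)"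
      using IH[of k] step by (simp add: scan_profile_def)
    show "osc_le n q (mean (sweep n q [k + 1..<n + 1]) f) i d" if "i \<in> {1..<k}" for i
      using IH[of i] that step.hyps by (simp add: scan_profile_def)
    show "osc_le n q (mean (sweep n q [k + 1..<n + 1]) f) (k + 1) (1 / 2 * d)" if "k + 1 \<le> n"
      using IH[of "k + 1"] that by (simp add: scan_profile_def)
    show "osc_le n q (mean (sweep n q [k + 1..<n + 1]) f) i (3 / 4 * d)" if "i \<in> {k + 2..n}" for i
      using IH[of i] that by (simp add: scan_profile_def)
  qed (use step in auto)
  then show ?case
    unfolding upt using q by (simp add: mean_sweep_Cons)
qed

lemma systematic_scan_eq_sweep: "systematic_scan n q = sweep n q [1..<n + 1]"
  by (simp only: fun_eq_iff systematic_scan_def sweep_def simp_thms)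

lemma finite_set_systematic_scan: "q > 0 \<Longrightarrow> finite (set_pmf (systematic_scan n q \<sigma>))"
  by (simp only: systematic_scan_eq_sweep finite_set_sweep)

lemma osc_systematic_scan:
  assumes "q > 4" "d \<ge> 0" "\<And>j. j \<in> {1..n} \<Longrightarrow> osc_le n q f j d" "j \<in> {1..n}"
  shows "osc_le n q (mean (systematic_scan n q) f) j ((if j = 1 then 1 / 2 else 3 / 4) * d)"
proof -
  have "n \<ge> 1" "scan_profile 1 j = (if j = 1 then 1 / 2 else 3 / 4)"
    using assms(4) by (auto simp: scan_profile_def)
  with osc_sweep[OF assms(1,2) order_refl _ assms(3,4)] show ?thesis
    by (simp only: systematic_scan_eq_sweep)
qed

section \<open>Mixing\<close>

text \<open>In the last of the \<open>t\<close> averages, site \<open>1\<close> contributes \<open>1/2\<close> and each other site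
  \<open>3/4\<close>, together \<open>3/4 (n - 1/3)\<close>.\<close>

lemma mean_scan_power_diff:
  assumes q: "q > 4" and n: "n \<ge> 1" and "t \<ge> 1" "d \<ge> 0"
    and "\<And>j. j \<in> {1..n} \<Longrightarrow> osc_le n q f j d"
    and xy: "x \<in> colorings n q" "y \<in> colorings n q"
  shows "\<bar>mean (kernel_power (systematic_scan n q) t) f x
       - mean (kernel_power (systematic_scan n q) t) f y\<bar> \<le> (n - 1 / 3) * (3 / 4) ^ t * d"
  using \<open>t \<ge> 1\<close> assms(4,5)
proof (induction t arbitrary: f d rule: dec_induct)
  case base
  let ?w = "\<lambda>j::nat. (if j = 1 then 1 / 2 else 3 / 4 :: real) * d"
  have "\<bar>mean (systematic_scan n q) f x - mean (systematic_scan n q) f y\<bar> \<le> (\<Sum>j=1..n. ?w j)"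
  proof (rule diff_le_sum_osc[OF xy, where d = ?w])
    show "osc_le n q (mean (systematic_scan n q) f) j (?w j)" if "j \<in> {1..n}" for j
      using q base that by (rule osc_systematic_scan)
  qed
  also have "\<dots> = d / 2 + (\<Sum>j=2..n. ?w j)"
    using n by (simp add: sum.atLeast_Suc_atMost numeral_2_eq_2)
  also have "(\<Sum>j=2..n. ?w j) = (\<Sum>j=2..n. 3 / 4 * d)"
    by (rule sum.cong) auto
  also have "d / 2 + (\<Sum>j=2..n. 3 / 4 * d) = (n - 1 / 3) * (3 / 4) ^ 1 * d"
    using n by (simp add: of_nat_diff field_simps)
  finally show ?case
    by (simp add: kernel_power_def bind_return_pmf mean_def)
next
  case (step t)
  have "osc_le n q (mean (systematic_scan n q) f) j (3 / 4 * d)" if "j \<in> {1..n}" for j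
    by (rule osc_le_mono[OF osc_systematic_scan[OF q step.prems(1) _ that]])
       (use step.prems in auto)
  from step.IH[OF _ this] step.prems(1) show ?case
    using q by (simp add: mean_kernel_power_Suc finite_set_systematic_scan mult_ac)
qed

lemma tv_dist_scan_power:
  assumes "q > 4" "n \<ge> 1" "t \<ge> 1" "x \<in> colorings n q"
  shows "tv_dist (colorings n q) (kernel_power (systematic_scan n q) t x) (uniform_proper n q)
    \<le> (n - 1 / 3) * (3 / 4) ^ t"
proof (rule tv_dist_le_of_mean_indicator[where K = "kernel_power (systematic_scan n q) t"])
  have "q \<ge> 2" using assms(1) by simp
  have set: "set_pmf (uniform_proper n q) = proper_colorings n q"
    using proper_colorings_nonempty[OF \<open>q \<ge> 2\<close>] finite_proper_colorings
    by (simp add: uniform_proper_def)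
  show "finite (set_pmf (uniform_proper n q))" "set_pmf (uniform_proper n q) \<subseteq> colorings n q"
    unfolding set using finite_proper_colorings by (auto simp: proper_colorings_def)
  show "finite (colorings n q)" by (simp add: colorings_def finite_PiE)
  show "finite (set_pmf (kernel_power (systematic_scan n q) t y))" for y
    using assms(1) by (intro finite_set_kernel_power finite_set_systematic_scan) simp
  show "stationary (kernel_power (systematic_scan n q) t) (uniform_proper n q)"
    using \<open>q \<ge> 2\<close> by (intro stationary_kernel_power stationary_systematic_scan)
  show "\<bar>mean (kernel_power (systematic_scan n q) t) (indicat_real A) x
       - mean (kernel_power (systematic_scan n q) t) (indicat_real A) y\<bar> \<le> (n - 1 / 3) * (3 / 4) ^ t"
    if "y \<in> colorings n q" for A y
    using mean_scan_power_diff[OF assms(1-3) _ osc_le_indicator assms(4) that] by simp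
qed (use assms in simp)

text \<open>Since \<open>exp (1/4) \<le> 4/3\<close>, comparing the two sides at the smallest \<open>t\<close> is enough.\<close>

lemma exp_quarter_le_power:
  assumes "c * exp ((real t0 + 1) / 4) \<le> (4 / 3) ^ t0" "t0 \<le> t" "c \<ge> 0"
  shows "c * exp ((real t + 1) / 4) \<le> (4 / 3 :: real) ^ t"
  using assms(2)
proof (induction t rule: dec_induct)
  case base
  show ?case using assms(1) .
next
  case (step t)
  have "exp (1 / 4 :: real) ^ 4 \<le> (4 / 3) ^ 4"
    using e_less_272 by (simp add: eval_nat_numeral flip: exp_of_nat_mult exp_add)
  then have "exp (1 / 4 :: real) \<le> 4 / 3"
    by (rule power_le_imp_le_base[of _ 3, simplified]) simp
  then have "exp (1 / 4) * (c * exp ((real t + 1) / 4)) \<le> 4 / 3 * (4 / 3) ^ t"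
    using step.IH assms(3) by (intro mult_mono) auto
  moreover have "(real (Suc t) + 1) / 4 = 1 / 4 + (real t + 1) / 4" by simp
  ultimately show ?case by (simp only: exp_add power_Suc mult_ac)
qed

text \<open>With \<open>r = n / \<epsilon>\<close> the claim reads \<open>(1 - 1/(3n)) r \<le> (4/3)^t\<close>, and \<open>t > 4 ln r - 1\<close> means
  \<open>r < exp ((t + 1) / 4)\<close>.  So the factor \<open>1 - 1/(3n)\<close> and the growth of
  \<open>(4/3)^t exp (-t/4)\<close> have to make up for the rounding.  For larger \<open>n\<close> the factor is weaker,
  but \<open>t\<close> is larger: from \<open>n = 7\<close> on, \<open>t \<ge> 7\<close> suffices without the factor, while the cases
  \<open>n = 4\<close>, \<open>t \<ge> 5\<close> and \<open>n \<le> 6\<close>, \<open>t \<ge> 6\<close> use it.\<close>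

lemma power_floor_bound:
  fixes n :: nat and \<epsilon> :: real
  assumes n: "n > 3" and e: "0 < \<epsilon>" "\<epsilon> < 1"
  defines "t \<equiv> nat \<lfloor>4 * ln (n / \<epsilon>)\<rfloor>"
  shows "t \<ge> 1" and "(n - 1 / 3) * (3 / 4) ^ t \<le> \<epsilon>"
proof -
  define r where "r = n / \<epsilon>"
  have r: "r > n" using n e by (simp add: r_def field_simps)
  then have "r > 0" by linarith
  \<comment> \<open>The bound \<open>2.72\<close> for \<open>exp 1\<close> is precise enough for all three cases below.\<close>
  have exp_nat: "exp (real k) \<le> (272 / 100) ^ k" for k
    using e_less_272 by (auto simp: exp_of_nat_mult[of k 1, simplified] intro!: power_mono)
  have t_ge: "m \<le> t" if "(272 / 100 :: real) ^ m \<le> r ^ 4" for m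
  proof -
    have "exp (real m) \<le> r ^ 4" using exp_nat[of m] that by linarith
    then have "real m \<le> ln (r ^ 4)" using \<open>r > 0\<close> by (simp add: ln_ge_iff)
    then have "real m \<le> 4 * ln r" using \<open>r > 0\<close> by (simp add: ln_realpow)
    then show ?thesis by (simp add: t_def flip: r_def) linarith
  qed
  have r4: "real m ^ 4 \<le> r ^ 4" if "m \<le> n" for m
    using that r by (intro power_mono) auto
  show "t \<ge> 1" using t_ge[of 1] r4[of 4] n by simp
  have "4 * ln r \<le> real t + 1" by (simp add: t_def flip: r_def) linarith
  then have "ln r \<le> (real t + 1) / 4" by simp
  then have r_le: "r \<le> exp ((real t + 1) / 4)"
    using \<open>r > 0\<close> by (metis exp_le_cancel_iff exp_ln)
  have exp_le: "exp ((real m + 1) / 4) \<le> b" if "(272 / 100) ^ (m + 1) \<le> b ^ 4" "b > 0" for m b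
  proof (rule power_le_imp_le_base[of _ 3, simplified])
    have "exp ((real m + 1) / 4) ^ 4 = exp (real (m + 1))"
      by (simp flip: exp_of_nat_mult)
    then show "exp ((real m + 1) / 4) ^ 4 \<le> b ^ 4"
      using exp_nat[of "m + 1"] that(1) by linarith
  qed (use that in simp)
  have "(1 - 1 / (3 * real n)) * exp ((real t + 1) / 4) \<le> (4 / 3) ^ t"
  proof -
    consider "n = 4" | "n \<in> {5, 6}" | "n \<ge> 7" using n by force
    then show ?thesis
    proof cases
      case 1
      have "5 \<le> t" by (rule t_ge, rule order_trans[OF _ r4[of 4]]) (use 1 in \<open>auto simp: power_divide\<close>)
      have "exp ((real 5 + 1) / 4) \<le> 459 / 100" by (rule exp_le) (simp_all add: field_simps)
      then have "11 / 12 * exp ((real 5 + 1) / 4) \<le> (4 / 3) ^ 5"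
        by (simp add: power_divide)
      then have "11 / 12 * exp ((real t + 1) / 4) \<le> (4 / 3) ^ t"
        by (intro exp_quarter_le_power[OF _ \<open>5 \<le> t\<close>]) simp_all
      then show ?thesis using 1 by simp
    next
      case 2
      have "6 \<le> t" by (rule t_ge, rule order_trans[OF _ r4[of 5]]) (use 2 in \<open>auto simp: power_divide\<close>)
      have "exp ((real 6 + 1) / 4) \<le> 594 / 100" by (rule exp_le) (simp_all add: field_simps)
      then have "17 / 18 * exp ((real 6 + 1) / 4) \<le> (4 / 3) ^ 6"
        by (simp add: power_divide)
      then have "17 / 18 * exp ((real t + 1) / 4) \<le> (4 / 3) ^ t"
        by (intro exp_quarter_le_power[OF _ \<open>6 \<le> t\<close>]) simp_all
      moreover have "1 - 1 / (3 * real n) \<le> 17 / 18" using 2 by auto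
      ultimately show ?thesis
        by (meson exp_ge_zero mult_right_mono order_trans)
    next
      case 3
      have "7 \<le> t" by (rule t_ge, rule order_trans[OF _ r4[of 7]]) (use 3 in \<open>auto simp: power_divide\<close>)
      have "exp ((real 7 + 1) / 4) \<le> 749 / 100" by (rule exp_le) (simp_all add: field_simps)
      then have "1 * exp ((real 7 + 1) / 4) \<le> (4 / 3) ^ 7"
        by (simp add: power_divide)
      then have "1 * exp ((real t + 1) / 4) \<le> (4 / 3) ^ t"
        by (intro exp_quarter_le_power[OF _ \<open>7 \<le> t\<close>]) simp_all
      moreover have "1 - 1 / (3 * real n) \<le> 1" by simp
      ultimately show ?thesis
        by (meson exp_ge_zero mult_right_mono order_trans)
    qed
  qed
  moreover have "(1 - 1 / (3 * real n)) * r \<le> (1 - 1 / (3 * real n)) * exp ((real t + 1) / 4)"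
    using n r_le by (intro mult_left_mono) auto
  ultimately have "(1 - 1 / (3 * real n)) * r \<le> (4 / 3) ^ t" by linarith
  then have "(1 - 1 / (3 * real n)) * r * \<epsilon> * (3 / 4) ^ t \<le> (4 / 3) ^ t * \<epsilon> * (3 / 4) ^ t"
    using e by (intro mult_right_mono) auto
  moreover have "(1 - 1 / (3 * real n)) * r * \<epsilon> = n - 1 / 3"
    using n e by (simp add: r_def field_simps)
  moreover have "(4 / 3) ^ t * \<epsilon> * (3 / 4) ^ t = \<epsilon>"
    by (simp flip: power_mult_distrib add: mult_ac)
  ultimately show "(n - 1 / 3) * (3 / 4) ^ t \<le> \<epsilon>" by simp
qed

theorem theorem26:
  fixes n q :: nat and \<epsilon> :: real
  assumes "n > 3" and "q > 4" and "\<epsilon> \<in> {0<..<1}"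
  shows "ereal_of_enat (mixing_time (colorings n q) (systematic_scan n q) (uniform_proper n q) \<epsilon>)
           \<le> ereal (4 * ln (real n * inverse \<epsilon>))"
proof -
  define t where "t = nat \<lfloor>4 * ln (n / \<epsilon>)\<rfloor>"
  have t: "t \<ge> 1" "(n - 1 / 3) * (3 / 4) ^ t \<le> \<epsilon>"
    using power_floor_bound[of n \<epsilon>] assms by (auto simp: t_def)
  have "mixing_time_from (colorings n q) (systematic_scan n q) (uniform_proper n q) \<epsilon> x \<le> enat t"
    if "x \<in> colorings n q" for x
    unfolding mixing_time_from_def
    using tv_dist_scan_power[of q n t x] assms that t by (intro INF_lower) auto
  then have "mixing_time (colorings n q) (systematic_scan n q) (uniform_proper n q) \<epsilon> \<le> enat t"
    unfolding mixing_time_def by (rule SUP_least)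
  then have "ereal_of_enat (mixing_time (colorings n q) (systematic_scan n q) (uniform_proper n q) \<epsilon>)
      \<le> ereal (real t)"
    by (metis ereal_of_enat_le_iff ereal_of_enat_simps(1))
  also have "real t \<le> 4 * ln (n / \<epsilon>)"
    using t(1) by (simp add: t_def) linarith
  finally show ?thesis by (simp add: divide_inverse)
qed

end
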